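(* Let $\alpha$ be a simple loop with $\mathrm{update}(\alpha)=\mu$ and $\mathrm{guard}(\alpha) = \varphi\land\psi$ such that $\mathrm{guard}(\alpha)\implies\psi\mu$ is valid. Let $b$ be an arithmetic expression such that the formulas \[ \neg\varphi\land\psi \implies b\leq 0 \qquad\text{and}\qquad \varphi\land\psi\implies b\mu\geq b-1 \] are valid. Then $\chi_\psi\cdot b$ is a metering function for $\alpha$.
   Context: Variables range over $\mathbb{Z}$. Arithmetic expressions are built from variables, numbers and operations such as $+,-,\cdot$, division and exponentiation; a constraint is a finite conjunction of inequations ($<,\leq,>,\geq$) between arithmetic expressions. A rule has the form $f(\vec x)\xrightarrow{c}T\ [\varphi]$ with a fixed vector $\vec x$ of pairwise different program variables, a function symbol $f$, a cost expression $c$, a finite multiset $T$ of terms $g(t_1,\dots,t_k)$ (with arithmetic expressions $t_i$) and a guard constraint $\varphi=\mathrm{guard}$. A substitution maps variables to arithmetic expressions and is applied homomorphically ($t\sigma$). A simple loop is a rule $\alpha$ of the form $f(\vec x)\xrightarrow{c}f(\vec x)\mu\ [\varphi]$, where $\mu$ is a substitution with $\mathrm{dom}(\mu)\subseteq\vec x$, called $\mathrm{update}(\alpha)$. An integer substitution maps variables in its domain to integers; $\sigma\models\varphi$ means all variables of $\varphi$ are in $\mathrm{dom}(\sigma)$ and $\sigma$ is a model of $\varphi$. A quantifier-free formula is valid if every integer substitution whose domain contains its variables is a model of it. For a constraint $\psi$, the characteristic function $\chi_\psi$ satisfies, for every integer substitution $\sigma$ whose domain contains the variables of $\psi$, $\chi_\psi\sigma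 = 1$ if $\sigma\models\psi$ and $\chi_\psi\sigma = 0$ otherwise. An arithmetic expression $b$ (possibly involving characteristic functions) is a metering function for a simple loop $\alpha$ with update $\mu$ if $\neg\mathrm{guard}(\alpha)\implies b\leq 0$ and $\mathrm{guard}(\alpha)\implies b\mu\geq b-1$ are valid. *)

theory Defs
  imports Complex_Main "HOL-Library.FSet" "HOL-Library.Multiset"
begin

section \<open>Arithmetic expressions and constraints\<close>

text \<open>
  A finite conjunction of inequations is represented by the finite set of its conjuncts, i.e.
  modulo associativity, commutativity and idempotence; \<open>Chi \<psi>\<close> is the characteristic function
  of the constraint \<open>\<psi>\<close>. Expressions without characteristic functions are singled out by
  \<open>chi_free\<close> below.
\<close>

datatype 'v aexp =
    Var 'v
  | Num real
  | Add "'v aexp" "'v aexp"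
  | Sub "'v aexp" "'v aexp"
  | Mul "'v aexp" "'v aexp"
  | Div "'v aexp" "'v aexp"
  | Pow "'v aexp" "'v aexp"
  | Chi "'v ineq fset"
and 'v ineq =
    Less "'v aexp" "'v aexp"
  | Leq "'v aexp" "'v aexp"
  | Greater "'v aexp" "'v aexp"
  | Geq "'v aexp" "'v aexp"

type_synonym 'v constr = "'v ineq fset"

primrec vars_aexp :: "'v aexp \<Rightarrow> 'v set" and vars_ineq :: "'v ineq \<Rightarrow> 'v set" where
  "vars_aexp (Var x) = {x}"
| "vars_aexp (Num r) = {}"
| "vars_aexp (Add s t) = vars_aexp s \<union> vars_aexp t"
| "vars_aexp (Sub s t) = vars_aexp s \<union> vars_aexp t"
| "vars_aexp (Mul s t) = vars_aexp s \<union> vars_aexp t"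
| "vars_aexp (Div s t) = vars_aexp s \<union> vars_aexp t"
| "vars_aexp (Pow s t) = vars_aexp s \<union> vars_aexp t"
| "vars_aexp (Chi \<psi>) = \<Union> (fset (vars_ineq |`| \<psi>))"
| "vars_ineq (Less s t) = vars_aexp s \<union> vars_aexp t"
| "vars_ineq (Leq s t) = vars_aexp s \<union> vars_aexp t"
| "vars_ineq (Greater s t) = vars_aexp s \<union> vars_aexp t"
| "vars_ineq (Geq s t) = vars_aexp s \<union> vars_aexp t"

definition vars_constr :: "'v constr \<Rightarrow> 'v set" where
  "vars_constr \<phi> = (\<Union>a \<in> fset \<phi>. vars_ineq a)"

primrec chi_free :: "'v aexp \<Rightarrow> bool" and chi_free_ineq :: "'v ineq \<Rightarrow> bool" where
  "chi_free (Var x) \<longleftrightarrow> True"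
| "chi_free (Num r) \<longleftrightarrow> True"
| "chi_free (Add s t) \<longleftrightarrow> chi_free s \<and> chi_free t"
| "chi_free (Sub s t) \<longleftrightarrow> chi_free s \<and> chi_free t"
| "chi_free (Mul s t) \<longleftrightarrow> chi_free s \<and> chi_free t"
| "chi_free (Div s t) \<longleftrightarrow> chi_free s \<and> chi_free t"
| "chi_free (Pow s t) \<longleftrightarrow> chi_free s \<and> chi_free t"
| "chi_free (Chi \<psi>) \<longleftrightarrow> False"
| "chi_free_ineq (Less s t) \<longleftrightarrow> chi_free s \<and> chi_free t"
| "chi_free_ineq (Leq s t) \<longleftrightarrow> chi_free s \<and> chi_free t"
| "chi_free_ineq (Greater s t) \<longleftrightarrow> chi_free s \<and> chi_free t"
| "chi_free_ineq (Geq s t) \<longleftrightarrow> chi_free s \<and> chi_free t"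

section \<open>Substitutions\<close>

type_synonym 'v subst = "'v \<Rightarrow> 'v aexp"

definition subst_dom :: "'v subst \<Rightarrow> 'v set" where
  "subst_dom \<mu> = {x. \<mu> x \<noteq> Var x}"

primrec subst_aexp :: "'v subst \<Rightarrow> 'v aexp \<Rightarrow> 'v aexp"
  and subst_ineq :: "'v subst \<Rightarrow> 'v ineq \<Rightarrow> 'v ineq" where
  "subst_aexp \<mu> (Var x) = \<mu> x"
| "subst_aexp \<mu> (Num r) = Num r"
| "subst_aexp \<mu> (Add s t) = Add (subst_aexp \<mu> s) (subst_aexp \<mu> t)"
| "subst_aexp \<mu> (Sub s t) = Sub (subst_aexp \<mu> s) (subst_aexp \<mu> t)"
| "subst_aexp \<mu> (Mul s t) = Mul (subst_aexp \<mu> s) (subst_aexp \<mu> t)"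
| "subst_aexp \<mu> (Div s t) = Div (subst_aexp \<mu> s) (subst_aexp \<mu> t)"
| "subst_aexp \<mu> (Pow s t) = Pow (subst_aexp \<mu> s) (subst_aexp \<mu> t)"
| "subst_aexp \<mu> (Chi \<psi>) = Chi (subst_ineq \<mu> |`| \<psi>)"
| "subst_ineq \<mu> (Less s t) = Less (subst_aexp \<mu> s) (subst_aexp \<mu> t)"
| "subst_ineq \<mu> (Leq s t) = Leq (subst_aexp \<mu> s) (subst_aexp \<mu> t)"
| "subst_ineq \<mu> (Greater s t) = Greater (subst_aexp \<mu> s) (subst_aexp \<mu> t)"
| "subst_ineq \<mu> (Geq s t) = Geq (subst_aexp \<mu> s) (subst_aexp \<mu> t)"

definition subst_constr :: "'v subst \<Rightarrow> 'v constr \<Rightarrow> 'v constr" where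
  "subst_constr \<mu> \<phi> = subst_ineq \<mu> |`| \<phi>"

section \<open>Integer substitutions, models and validity\<close>

text \<open>
  An integer substitution is a partial map into the integers. Expressions are evaluated over the
  reals because of division and exponentiation.
\<close>

type_synonym 'v isubst = "'v \<rightharpoonup> int"

text \<open>
  The library's \<open>powr\<close> is not the usual power for negative bases (and gives \<open>0\<close> for \<open>0\<close> to the \<open>0\<close>),
  hence \<open>powi\<close> for integral exponents.
\<close>

definition real_pow :: "real \<Rightarrow> real \<Rightarrow> real" where
  "real_pow x y = (if y \<in> \<int> then x powi \<lfloor>y\<rfloor> else x powr y)"

primrec eval :: "'v isubst \<Rightarrow> 'v aexp \<Rightarrow> real" and eval_ineq :: "'v isubst \<Rightarrow> 'v ineq \<Rightarrow> bool" where
  "eval \<sigma> (Var x) = of_int (the (\<sigma> x))"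
| "eval \<sigma> (Num r) = r"
| "eval \<sigma> (Add s t) = eval \<sigma> s + eval \<sigma> t"
| "eval \<sigma> (Sub s t) = eval \<sigma> s - eval \<sigma> t"
| "eval \<sigma> (Mul s t) = eval \<sigma> s * eval \<sigma> t"
| "eval \<sigma> (Div s t) = eval \<sigma> s / eval \<sigma> t"
| "eval \<sigma> (Pow s t) = real_pow (eval \<sigma> s) (eval \<sigma> t)"
| "eval \<sigma> (Chi \<psi>) = (if False |\<in>| eval_ineq \<sigma> |`| \<psi> then 0 else 1)"
| "eval_ineq \<sigma> (Less s t) \<longleftrightarrow> eval \<sigma> s < eval \<sigma> t"
| "eval_ineq \<sigma> (Leq s t) \<longleftrightarrow> eval \<sigma> s \<le> eval \<sigma> t"
| "eval_ineq \<sigma> (Greater s t) \<longleftrightarrow> eval \<sigma> s > eval \<sigma> t"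
| "eval_ineq \<sigma> (Geq s t) \<longleftrightarrow> eval \<sigma> s \<ge> eval \<sigma> t"

datatype 'v qff =
    Constr "'v constr"
  | Neg "'v qff"
  | Conj "'v qff" "'v qff"
  | Imp "'v qff" "'v qff"

primrec vars_qff :: "'v qff \<Rightarrow> 'v set" where
  "vars_qff (Constr \<phi>) = vars_constr \<phi>"
| "vars_qff (Neg F) = vars_qff F"
| "vars_qff (Conj F G) = vars_qff F \<union> vars_qff G"
| "vars_qff (Imp F G) = vars_qff F \<union> vars_qff G"

primrec eval_qff :: "'v isubst \<Rightarrow> 'v qff \<Rightarrow> bool" where
  "eval_qff \<sigma> (Constr \<phi>) \<longleftrightarrow> (\<forall>a \<in> fset \<phi>. eval_ineq \<sigma> a)"
| "eval_qff \<sigma> (Neg F) \<longleftrightarrow> \<not> eval_qff \<sigma> F"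
| "eval_qff \<sigma> (Conj F G) \<longleftrightarrow> eval_qff \<sigma> F \<and> eval_qff \<sigma> G"
| "eval_qff \<sigma> (Imp F G) \<longleftrightarrow> (eval_qff \<sigma> F \<longrightarrow> eval_qff \<sigma> G)"

definition models :: "'v isubst \<Rightarrow> 'v qff \<Rightarrow> bool" where
  "models \<sigma> F \<longleftrightarrow> vars_qff F \<subseteq> dom \<sigma> \<and> eval_qff \<sigma> F"

definition valid :: "'v qff \<Rightarrow> bool" where
  "valid F \<longleftrightarrow> (\<forall>\<sigma>. vars_qff F \<subseteq> dom \<sigma> \<longrightarrow> models \<sigma> F)"

lemma eval_Chi:
  assumes "vars_constr \<psi> \<subseteq> dom \<sigma>"
  shows "eval \<sigma> (Chi \<psi>) = (if models \<sigma> (Constr \<psi>) then 1 else 0)"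
  using assms by (auto simp: models_def image_iff)

section \<open>Rules, simple loops and metering functions\<close>

datatype ('f, 'v) trm = Fun 'f "'v aexp list"

primrec subst_trm :: "'v subst \<Rightarrow> ('f, 'v) trm \<Rightarrow> ('f, 'v) trm" where
  "subst_trm \<mu> (Fun f ts) = Fun f (map (subst_aexp \<mu>) ts)"

primrec chi_free_trm :: "('f, 'v) trm \<Rightarrow> bool" where
  "chi_free_trm (Fun f ts) \<longleftrightarrow> (\<forall>t \<in> set ts. chi_free t)"

record ('f, 'v) rule =
  fun_sym :: 'f
  prog_vars :: "'v list"
  cost :: "'v aexp"
  rhs :: "('f, 'v) trm multiset"
  guard :: "'v constr"

definition lhs :: "('f, 'v) rule \<Rightarrow> ('f, 'v) trm" where
  "lhs \<alpha> = Fun (fun_sym \<alpha>) (map Var (prog_vars \<alpha>))"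

definition is_rule :: "('f, 'v) rule \<Rightarrow> bool" where
  "is_rule \<alpha> \<longleftrightarrow> distinct (prog_vars \<alpha>) \<and> chi_free (cost \<alpha>) \<and>
     (\<forall>t \<in># rhs \<alpha>. chi_free_trm t) \<and> (\<forall>a \<in> fset (guard \<alpha>). chi_free_ineq a)"

definition is_update :: "('f, 'v) rule \<Rightarrow> 'v subst \<Rightarrow> bool" where
  "is_update \<alpha> \<mu> \<longleftrightarrow> subst_dom \<mu> \<subseteq> set (prog_vars \<alpha>) \<and> rhs \<alpha> = {# subst_trm \<mu> (lhs \<alpha>) #}"

definition simple_loop :: "('f, 'v) rule \<Rightarrow> bool" where
  "simple_loop \<alpha> \<longleftrightarrow> is_rule \<alpha> \<and> (\<exists>\<mu>. is_update \<alpha> \<mu>)"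

definition update :: "('f, 'v) rule \<Rightarrow> 'v subst" where
  "update \<alpha> = (THE \<mu>. is_update \<alpha> \<mu>)"

lemma is_update_unique:
  assumes "is_update \<alpha> \<mu>" "is_update \<alpha> \<nu>"
  shows "\<mu> = \<nu>"
proof
  fix x
  show "\<mu> x = \<nu> x"
  proof (cases "x \<in> set (prog_vars \<alpha>)")
    case True
    then show ?thesis using assms by (auto simp: is_update_def lhs_def)
  next
    case False
    then have "\<mu> x = Var x" "\<nu> x = Var x"
      using assms unfolding is_update_def subst_dom_def by blast+
    then show ?thesis by simp
  qed
qed

lemma update_eqI: "is_update \<alpha> \<mu> \<Longrightarrow> update \<alpha> = \<mu>"
  unfolding update_def by (blast intro: is_update_unique)

definition metering_function :: "('f, 'v) rule \<Rightarrow> 'v aexp \<Rightarrow> bool" where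
  "metering_function \<alpha> b \<longleftrightarrow>
     valid (Imp (Neg (Constr (guard \<alpha>))) (Constr {| Leq b (Num 0) |})) \<and>
     valid (Imp (Constr (guard \<alpha>))
       (Constr {| Geq (subst_aexp (update \<alpha>) b) (Sub b (Num 1)) |}))"

end

theory Submission
  imports Defs
begin

text \<open>The factor \<open>Chi \<psi>\<close> discards \<open>b\<close> wherever \<psi> fails:
  the product is then 0, so at most 0. If the guard fails although \<psi> holds, then \<phi> fails
  and the assumption on \<open>b\<close> applies. If the guard holds, so does \<psi>, and its
  invariance gives \<psi> after the update, so both characteristic functions are 1 and the decrease
  condition reduces to the one for \<open>b\<close>. This rests on \<open>subst_Chi\<close> and
  \<open>eval_Chi_eval_qff\<close>.\<close>

lemma valid_iff: "valid F \<longleftrightarrow> (\<forall>\<sigma>. vars_qff F \<subseteq> dom \<sigma> \<longrightarrow> eval_qff \<sigma> F)"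
  by (auto simp: valid_def models_def)

lemma eval_Chi_eval_qff: "eval \<sigma> (Chi \<psi>) = (if eval_qff \<sigma> (Constr \<psi>) then 1 else 0)"
  by (auto simp: image_iff)

lemma vars_Chi: "vars_aexp (Chi \<psi>) = vars_constr \<psi>"
  by (simp add: vars_constr_def)

lemma subst_Chi: "subst_aexp \<mu> (Chi \<psi>) = Chi (subst_constr \<mu> \<psi>)"
  by (simp add: subst_constr_def)

lemma vars_constr_funion: "vars_constr (\<phi> |\<union>| \<psi>) = vars_constr \<phi> \<union> vars_constr \<psi>"
  by (auto simp: vars_constr_def)

lemma eval_qff_funion:
  "eval_qff \<sigma> (Constr (\<phi> |\<union>| \<psi>)) \<longleftrightarrow> eval_qff \<sigma> (Constr \<phi>) \<and> eval_qff \<sigma> (Constr \<psi>)"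
  by auto

lemma vars_constr_finsert_fempty: "vars_constr {|a|} = vars_ineq a"
  by (simp add: vars_constr_def)

theorem theorem3p4:
  fixes \<alpha> :: "('f, 'v) rule"
    and \<mu> :: "'v subst"
    and \<phi> \<psi> :: "'v constr"
    and b :: "'v aexp"
  assumes "simple_loop \<alpha>"
    and "update \<alpha> = \<mu>"
    and "guard \<alpha> = \<phi> |\<union>| \<psi>"
    and "valid (Imp (Constr (guard \<alpha>)) (Constr (subst_constr \<mu> \<psi>)))"
    and "valid (Imp (Conj (Neg (Constr \<phi>)) (Constr \<psi>)) (Constr {| Leq b (Num 0) |}))"
    and "valid (Imp (Conj (Constr \<phi>) (Constr \<psi>))
           (Constr {| Geq (subst_aexp \<mu> b) (Sub b (Num 1)) |}))"
  shows "metering_function \<alpha> (Mul (Chi \<psi>) b)"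
proof -
  note vars_simps = vars_constr_funion vars_constr_finsert_fempty vars_Chi
  note Chi_simps = eval_Chi_eval_qff subst_Chi
  have "eval_qff \<sigma> (Imp (Neg (Constr (guard \<alpha>))) (Constr {| Leq (Mul (Chi \<psi>) b) (Num 0) |}))"
    if "vars_constr (guard \<alpha>) \<union> (vars_constr \<psi> \<union> vars_aexp b) \<subseteq> dom \<sigma>" for \<sigma>
  proof -
    \<comment> \<open>The variables of this formula are among those of the goal, so its validity
      applies at \<open>\<sigma>\<close>.\<close>
    have "eval_qff \<sigma> (Imp (Conj (Neg (Constr \<phi>)) (Constr \<psi>)) (Constr {| Leq b (Num 0) |}))"
      using assms(5) that unfolding valid_iff assms(3) by (simp add: vars_simps del: vars_aexp.simps(8))
    then show ?thesis
      \<comment> \<open>If \<psi> fails, the product is 0; otherwise it is \<open>b\<close>, and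
        \<phi> must be what fails.\<close>
      unfolding assms(3) by (auto simp: Chi_simps simp del: eval.simps(8))
  qed
  moreover have "eval_qff \<sigma> (Imp (Constr (guard \<alpha>))
      (Constr {| Geq (subst_aexp \<mu> (Mul (Chi \<psi>) b)) (Sub (Mul (Chi \<psi>) b) (Num 1)) |}))"
    \<comment> \<open>The variable set is written with the substitution already pushed through
      \<open>Mul\<close> and \<open>Chi\<close>, the form the closing simplification
      produces.\<close>
    if dom: "vars_constr (guard \<alpha>) \<union> (vars_constr (subst_constr \<mu> \<psi>) \<union> vars_aexp (subst_aexp \<mu> b)
      \<union> (vars_constr \<psi> \<union> vars_aexp b)) \<subseteq> dom \<sigma>" for \<sigma>
  proof -
    \<comment> \<open>This makes the characteristic function equal 1 after the update as
      well.\<close>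
    have "eval_qff \<sigma> (Imp (Constr (guard \<alpha>)) (Constr (subst_constr \<mu> \<psi>)))"
      using assms(4) dom unfolding valid_iff by simp
    moreover have "eval_qff \<sigma> (Imp (Conj (Constr \<phi>) (Constr \<psi>))
        (Constr {| Geq (subst_aexp \<mu> b) (Sub b (Num 1)) |}))"
      using assms(6) dom unfolding valid_iff assms(3) by (simp add: vars_simps)
    ultimately show ?thesis
      unfolding assms(3)
      by (auto simp: Chi_simps eval_qff_funion simp del: eval.simps(8) subst_aexp.simps(8))
  qed
  ultimately show ?thesis
    unfolding metering_function_def valid_iff assms(2)
    \<comment> \<open>Only variable sets and the substituted \<open>Chi\<close> are rewritten;
      without \<open>eval_qff.simps\<close> the formulas stay folded and match the two
      facts.\<close>
    by (simp add: vars_simps subst_Chi del: vars_aexp.simps(8) subst_aexp.simps(8) eval_qff.simps)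
qed

end
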